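(* Let $G$ be a connected graph with $|G|\ge 2$, let $H$ be a graph, and let $K$ be a nonempty induced subgraph of the lexicographic product $G[H]$, with projection $\pi(K)$. Then: if $|\pi(K)|\ge 2$, $K\le G[H]$ if and only if $\pi(K)\le G$; and if $|\pi(K)|=1$, $K\le G[H]$ if and only if $\operatorname{diam}(K)\le 2$.
   Context: All graphs are finite, undirected and simple; $|G|$ denotes the number of vertices of $G$. The distance $d_G(u,v)$ is the minimum length (number of edges) of a path from $u$ to $v$ in $G$, and $d_G(u,v)=\infty$ if no such path exists. A subgraph $K$ of $G$ is isometric, written $K\le G$, if $d_K(u,v)=d_G(u,v)$ for every pair of vertices $u,v\in V(K)$. The diameter $\operatorname{diam}(K)$ is the maximum of $d_K(p,q)$ over vertices $p,q$ of $K$ (so it is $\infty$ if $K$ is disconnected). The lexicographic product $G[H]$ is the graph with vertex set $V(G)\times V(H)$ and edge set $E(G[H])=\{(u,x)(v,y) : uv\in E(G),\text{ or } (xy\in E(H)\text{ and }u=v)\}$. The projection $\pi(K)$ of a subgraph $K$ of $G[H]$ is the induced subgraph of $G$ whose vertex set is $\{u : (u,x)\text{ is a vertex of }K \text{ for some } x\in V(H)\}$. *)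

theory Defs
  imports "Graph_Theory.Digraph_Component" "HOL-Library.Extended_Nat"
begin

text \<open>
  A finite simple graph is a \<^locale>\<open>pair_graph\<close>, so an undirected edge $uv$ is represented by the
  two arcs $(u,v)$ and $(v,u)$, and the number of edges of a path is the length of its arc list.
\<close>

text \<open>The infimum of the empty set is \<open>\<infinity>\<close>, the value for vertices not joined by a path.\<close>

definition graph_dist :: "('a, 'b) pre_digraph \<Rightarrow> 'a \<Rightarrow> 'a \<Rightarrow> enat" where
  "graph_dist G u v = (INF p\<in>{p. pre_digraph.apath G u p v}. enat (length p))"

definition isometric_subgraph :: "('a, 'b) pre_digraph \<Rightarrow> ('a, 'b) pre_digraph \<Rightarrow> bool" where
  "isometric_subgraph K G \<longleftrightarrow>
     subgraph K G \<and> (\<forall>u\<in>verts K. \<forall>v\<in>verts K. graph_dist K u v = graph_dist G u v)"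

text \<open>For finite nonempty graphs the supremum is a maximum.\<close>

definition graph_diam :: "('a, 'b) pre_digraph \<Rightarrow> enat" where
  "graph_diam K = (SUP (p, q)\<in>verts K \<times> verts K. graph_dist K p q)"

definition lexicographic_product ::
  "'a pair_pre_digraph \<Rightarrow> 'b pair_pre_digraph \<Rightarrow> ('a \<times> 'b) pair_pre_digraph" where
  "lexicographic_product G H =
     \<lparr> pverts = pverts G \<times> pverts H,
       parcs = {((u, x), (v, y)) | u x v y.
         u \<in> pverts G \<and> v \<in> pverts G \<and> x \<in> pverts H \<and> y \<in> pverts H \<and>
         ((u, v) \<in> parcs G \<or> ((x, y) \<in> parcs H \<and> u = v))} \<rparr>"

lemma pair_graph_lexicographic_product:
  assumes "pair_graph G" and "pair_graph H"
  shows "pair_graph (lexicographic_product G H)"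
proof -
  interpret G: pair_graph G by fact
  interpret H: pair_graph H by fact
  let ?P = "lexicographic_product G H"
  have "finite (pverts ?P)"
    using G.pair_finite_verts H.pair_finite_verts by (simp add: lexicographic_product_def)
  moreover have "parcs ?P \<subseteq> pverts ?P \<times> pverts ?P"
    by (auto simp: lexicographic_product_def)
  ultimately have "finite (parcs ?P)"
    by (meson finite_SigmaI finite_subset)
  moreover have "symmetric (with_proj ?P)"
    by (auto simp: symmetric_def lexicographic_product_def sym_def
        intro: G.arcs_symmetric H.arcs_symmetric)
  ultimately show ?thesis
    using \<open>finite (pverts ?P)\<close>
    by unfold_locales
      (auto simp: lexicographic_product_def dest: G.no_loops' H.no_loops')
qed

definition projection ::
  "'a pair_pre_digraph \<Rightarrow> ('a \<times> 'b) pair_pre_digraph \<Rightarrow> ('a, 'a \<times> 'a) pre_digraph" where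
  "projection G K =
     with_proj G \<restriction> {u. \<exists>x. (u, x) \<in> pverts K}"

end

theory Submission
  imports Defs
begin

text \<open>
  Between vertices in different fibres, walks of \<open>K\<close> project to walks of \<open>\<pi>(K)\<close> that are no longer, and
  walks of \<open>\<pi>(K)\<close> lift to walks of \<open>K\<close> of the same length; so the two distances agree. The same
  holds for \<open>G[H]\<close>, whose projection is \<open>G\<close>. Within a fibre, going to a neighbouring fibre and back
  shows that distances are at most 2, and in an induced subgraph a distance of at most 2 is always
  the distance of the ambient graph.
\<close>

section \<open>Distance in terms of powers of the adjacency relation\<close>

lemma (in wf_digraph) awalk_imp_relpow_arcs_ends:
  "awalk u p v \<Longrightarrow> (u, v) \<in> arcs_ends G ^^ length p"
proof (induction p arbitrary: u)
  case Nil
  then show ?case by (simp add: awalk_Nil_iff)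
next
  case (Cons e p)
  then have "(u, head G e) \<in> arcs_ends G" "(head G e, v) \<in> arcs_ends G ^^ length p"
    by (auto simp: awalk_Cons_iff in_arcs_imp_in_arcs_ends)
  then show ?case by (simp only: list.size add_Suc_right add_0_right) (rule relpow_Suc_I2)
qed

lemma (in wf_digraph) relpow_arcs_ends_imp_awalk:
  assumes "(u, v) \<in> arcs_ends G ^^ n" and "u \<in> verts G"
  obtains p where "awalk u p v" and "length p = n"
  using assms
proof (induction n arbitrary: u thesis)
  case 0
  then show ?case by (metis awalk_Nil_iff list.size(3) relpow_0_E)
next
  case (Suc n)
  from Suc.prems(2) obtain w where w: "(u, w) \<in> arcs_ends G" "(w, v) \<in> arcs_ends G ^^ n"
    by (rule relpow_Suc_E2)
  then obtain e where e: "e \<in> arcs G" "u = tail G e" "w = head G e"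
    by (auto simp: arcs_ends_conv)
  obtain p where "awalk w p v" "length p = n"
    by (rule Suc.IH[of w]) (use w(2) e in auto)
  with e show ?case
    by (intro Suc.prems(1)[of "e # p"]) (auto simp: awalk_Cons_iff)
qed

text \<open>Each reduction step replaces \<open>q @ r @ s\<close> by \<open>q @ s\<close>, cutting
  out a closed walk \<open>r\<close>. Hence walks can replace paths when a distance is bounded from
  above.\<close>

lemma (in wf_digraph) length_awalk_to_apath_le:
  assumes "awalk u p v"
  shows "length (awalk_to_apath p) \<le> length p"
  using assms
proof (induct rule: awalk_to_apath_induct)
  case (path p)
  then show ?case by (auto simp: awalk_to_apath.simps)
next
  case (decomp p q r s)
  moreover from this have "p = q @ r @ s"
    by (auto elim: awalk_cyc_decompE)
  ultimately show ?case using step_awalk_to_apath[of u p v q r s] by simp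
qed

text \<open>A bound by \<open>n\<close> is a strict bound by \<open>Suc n\<close>, and a strict
  bound on an infimum passes to a member of the family. For empty \<open>A\<close> the infimum is
  \<infinity> and both sides fail.\<close>

lemma enat_INF_le_iff:
  fixes f :: "'a \<Rightarrow> enat"
  shows "(INF x\<in>A. f x) \<le> enat n \<longleftrightarrow> (\<exists>x\<in>A. f x \<le> enat n)"
proof
  assume "(INF x\<in>A. f x) \<le> enat n"
  then have "(INF x\<in>A. f x) < enat (Suc n)"
    by (meson enat_ord_simps(2) lessI order_le_less_trans)
  then obtain x where "x \<in> A" "f x < enat (Suc n)"
    by (auto simp: INF_less_iff)
  then show "\<exists>x\<in>A. f x \<le> enat n"
    by (cases "f x") (auto intro!: bexI[of _ x])
next
  assume "\<exists>x\<in>A. f x \<le> enat n"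
  then show "(INF x\<in>A. f x) \<le> enat n"
    by (auto intro: INF_lower2)
qed

text \<open>This reduces every later comparison of distances to powers of a relation. The vertex
  \<open>u\<close> must belong to the graph because the zeroth power relates every element of the
  type to itself, whereas empty walks exist only at vertices.\<close>

lemma (in wf_digraph) graph_dist_le_iff:
  assumes "u \<in> verts G"
  shows "graph_dist G u v \<le> enat n \<longleftrightarrow> (\<exists>k\<le>n. (u, v) \<in> arcs_ends G ^^ k)"
proof -
  have "(\<exists>p. apath u p v \<and> length p \<le> n) \<longleftrightarrow> (\<exists>k\<le>n. (u, v) \<in> arcs_ends G ^^ k)"
  proof
    assume "\<exists>p. apath u p v \<and> length p \<le> n"
    then show "\<exists>k\<le>n. (u, v) \<in> arcs_ends G ^^ k"
      by (auto simp: apath_def dest: awalk_imp_relpow_arcs_ends)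
  next
    assume "\<exists>k\<le>n. (u, v) \<in> arcs_ends G ^^ k"
    then obtain k where "k \<le> n" "(u, v) \<in> arcs_ends G ^^ k" by blast
    moreover from this(2) assms obtain p where "awalk u p v" "length p = k"
      by (rule relpow_arcs_ends_imp_awalk)
    ultimately have "awalk u p v" "length p \<le> n" by auto
    then show "\<exists>p. apath u p v \<and> length p \<le> n"
      using apath_awalk_to_apath length_awalk_to_apath_le le_trans by blast
  qed
  then show ?thesis
    by (simp add: graph_dist_def enat_INF_le_iff)
qed

lemma enat_leI:
  fixes a b :: enat
  assumes "\<And>n. b \<le> enat n \<Longrightarrow> a \<le> enat n"
  shows "a \<le> b"
  using assms by (cases b) auto

section \<open>Short distances in induced subgraphs\<close>

lemma relpow_mono:
  fixes R S :: "('a \<times> 'a) set"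
  assumes "R \<subseteq> S"
  shows "R ^^ n \<subseteq> S ^^ n"
  using assms by (induction n) (simp_all add: relcomp_mono)

text \<open>Distances 0 and 1 depend only on the two vertices and the arc between them, which an
  induced subgraph keeps. So a shorter connection in \<open>P\<close> would already be present in
  \<open>K\<close>.\<close>

lemma graph_dist_eq_if_le_2:
  assumes ind: "induced_subgraph K P" and u: "u \<in> verts K" and v: "v \<in> verts K"
    and le2: "graph_dist K u v \<le> 2"
  shows "graph_dist K u v = graph_dist P u v"
proof (rule antisym)
  from ind have sub: "subgraph K P" by (rule induced_imp_subgraph)
  interpret K: wf_digraph K using sub by (simp add: subgraph_def)
  interpret P: wf_digraph P using sub by (simp add: subgraph_def)
  from sub u have uP: "u \<in> verts P" by (auto simp: subgraph_def)
  have mono: "arcs_ends K \<subseteq> arcs_ends P"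
    using sub by (rule arcs_ends_mono)
  show "graph_dist P u v \<le> graph_dist K u v"
    using relpow_mono[OF mono, THEN subsetD]
    by - (rule enat_leI, auto simp: K.graph_dist_le_iff[OF u] P.graph_dist_le_iff[OF uP])
  have arcs: "(u, v) \<in> arcs_ends K" if uv: "(u, v) \<in> arcs_ends P"
  proof -
    obtain e where e: "e \<in> arcs P" "u = tail P e" "v = head P e"
      using uv by (auto simp: arcs_ends_conv)
    then have "e \<in> arcs K"
      using ind u v by (simp add: induced_subgraph_def)
    moreover have "compatible P K"
      using sub by (simp add: subgraph_def)
    ultimately show ?thesis
      using e by (metis K.in_arcs_imp_in_arcs_ends compatible_head compatible_tail)
  qed
  show "graph_dist K u v \<le> graph_dist P u v"
  proof (rule enat_leI)
    fix n assume n: "graph_dist P u v \<le> enat n"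
    show "graph_dist K u v \<le> enat n"
    \<comment> \<open>A walk of length 0 or 1 in \<open>P\<close> has no inner vertices and
      therefore lies in \<open>K\<close>; for larger \<open>n\<close> the assumed bound 2 is
      enough.\<close>
    proof (cases "n < 2")
      case True
      obtain k where k: "k \<le> n" "(u, v) \<in> arcs_ends P ^^ k"
        using n P.graph_dist_le_iff[OF uP] by auto
      from True k(1) consider "k = 0" | "k = 1" by linarith
      then have "(u, v) \<in> arcs_ends K ^^ k"
        using k(2) arcs by cases auto
      with k show ?thesis using K.graph_dist_le_iff[OF u] by blast
    next
      case False
      then have "2 \<le> enat n" by (simp add: numeral_eq_enat)
      with le2 show ?thesis by (rule order_trans)
    qed
  qed
qed

section \<open>Walks and distances under projection\<close>

lemma verts_projection [simp]: "u \<in> verts (projection G K) \<longleftrightarrow> (\<exists>x. (u, x) \<in> pverts K)"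
  by (simp add: projection_def)

lemma arcs_ends_projection_iff:
  "(u, v) \<in> arcs_ends (projection G K) \<longleftrightarrow>
     (u, v) \<in> parcs G \<and> u \<in> verts (projection G K) \<and> v \<in> verts (projection G K)"
  by (auto simp: projection_def arcs_ends_conv)

lemma parcs_induced_lexicographic_iff:
  assumes "induced_subgraph (with_proj K) (with_proj (lexicographic_product G H))"
  shows "((u, x), (v, y)) \<in> parcs K \<longleftrightarrow>
     (u, x) \<in> pverts K \<and> (v, y) \<in> pverts K \<and> ((u, v) \<in> parcs G \<or> (x, y) \<in> parcs H \<and> u = v)"
proof -
  have "pverts K \<subseteq> pverts G \<times> pverts H"
    and "parcs K = {e \<in> parcs (lexicographic_product G H). fst e \<in> pverts K \<and> snd e \<in> pverts K}"
    using assms by (auto simp: induced_subgraph_def subgraph_def lexicographic_product_def)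
  then show ?thesis by (auto simp: lexicographic_product_def)
qed

text \<open>Arcs inside a fibre collapse to a point and all others project to arcs, so the projected
  walk may be shorter.\<close>

lemma walk_projection:
  assumes ind: "induced_subgraph (with_proj K) (with_proj (lexicographic_product G H))"
    and "(a, b) \<in> parcs K ^^ n"
  shows "\<exists>k\<le>n. (fst a, fst b) \<in> arcs_ends (projection G K) ^^ k"
  using assms(2)
proof (induction n arbitrary: b)
  case 0
  then show ?case by auto
next
  case (Suc n)
  then obtain c where c: "(a, c) \<in> parcs K ^^ n" "(c, b) \<in> parcs K"
    by (auto elim: relpow_Suc_E)
  from Suc.IH[OF c(1)] obtain k where k: "k \<le> n" "(fst a, fst c) \<in> arcs_ends (projection G K) ^^ k"
    by blast
  have "fst c = fst b \<or> (fst c, fst b) \<in> arcs_ends (projection G K)"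
    using c(2) parcs_induced_lexicographic_iff[OF ind, of "fst c" "snd c" "fst b" "snd b"]
    by (cases c; cases b) (auto simp: arcs_ends_projection_iff)
  then show ?case
  proof
    assume "fst c = fst b"
    with k show ?thesis by (auto intro: le_SucI)
  next
    assume "(fst c, fst b) \<in> arcs_ends (projection G K)"
    with k(2) have "(fst a, fst b) \<in> arcs_ends (projection G K) ^^ Suc k"
      by (rule relpow_Suc_I)
    with k(1) show ?thesis by (intro exI[of _ "Suc k"]) auto
  qed
qed

text \<open>An arc of \<open>G\<close> joins every vertex of one fibre to every vertex of the other,
  so inner vertices can be lifted to any vertices of \<open>K\<close> above them and both ends can
  be prescribed. The length is positive because a walk of length 0 would force
  \<open>x = y\<close>.\<close>

lemma walk_lift:
  assumes ind: "induced_subgraph (with_proj K) (with_proj (lexicographic_product G H))"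
    and "(u, v) \<in> arcs_ends (projection G K) ^^ Suc n"
    and "(u, x) \<in> pverts K" and y: "(v, y) \<in> pverts K"
  shows "((u, x), (v, y)) \<in> parcs K ^^ Suc n"
  using assms(2,3)
proof (induction n arbitrary: u x)
  case 0
  then show ?case
    using y by (simp add: arcs_ends_projection_iff parcs_induced_lexicographic_iff[OF ind])
next
  case (Suc n)
  from Suc.prems(1) obtain w where w: "(u, w) \<in> arcs_ends (projection G K)"
      "(w, v) \<in> arcs_ends (projection G K) ^^ Suc n"
    by (rule relpow_Suc_E2)
  then obtain z where z: "(w, z) \<in> pverts K"
    by (auto simp: arcs_ends_projection_iff)
  have "((u, x), (w, z)) \<in> parcs K"
    using w z Suc.prems(2) by (simp add: arcs_ends_projection_iff parcs_induced_lexicographic_iff[OF ind])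
  with Suc.IH[OF w(2) z] show ?case by (rule relpow_Suc_I2[rotated])
qed

lemma wf_digraph_projection: "wf_digraph (with_proj G) \<Longrightarrow> wf_digraph (projection G K)"
  unfolding projection_def by (rule wf_digraph.wellformed_induce_subgraph)

text \<open>Walks transfer in both directions by \<open>walk_projection\<close> and
  \<open>walk_lift\<close>. As \<open>K\<close> is arbitrary, the product itself can be taken for
  \<open>K\<close>.\<close>

lemma graph_dist_projection:
  assumes wf: "wf_digraph (with_proj G)"
    and ind: "induced_subgraph (with_proj K) (with_proj (lexicographic_product G H))"
    and x: "(u, x) \<in> pverts K" and y: "(v, y) \<in> pverts K" and "u \<noteq> v"
  shows "graph_dist (with_proj K) (u, x) (v, y) = graph_dist (projection G K) u v"
proof -
  interpret K: wf_digraph "with_proj K"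
    using ind by (simp add: induced_subgraph_def subgraph_def)
  interpret \<pi>: wf_digraph "projection G K"
    using wf by (rule wf_digraph_projection)
  have u: "u \<in> verts (projection G K)" and x': "(u, x) \<in> verts (with_proj K)" using x by auto
  have "(\<exists>k\<le>n. ((u, x), (v, y)) \<in> parcs K ^^ k) \<longleftrightarrow>
      (\<exists>k\<le>n. (u, v) \<in> arcs_ends (projection G K) ^^ k)" for n
  proof
    assume "\<exists>k\<le>n. ((u, x), (v, y)) \<in> parcs K ^^ k"
    then obtain k where "k \<le> n" "((u, x), (v, y)) \<in> parcs K ^^ k" by blast
    then show "\<exists>k\<le>n. (u, v) \<in> arcs_ends (projection G K) ^^ k"
      using walk_projection[OF ind, of "(u, x)" "(v, y)" k] by (auto intro: le_trans)
  next
    assume "\<exists>k\<le>n. (u, v) \<in> arcs_ends (projection G K) ^^ k"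
    then obtain k where k: "k \<le> n" "(u, v) \<in> arcs_ends (projection G K) ^^ k" by blast
    \<comment> \<open>Distinct ends exclude length 0, the one length that \<open>walk_lift\<close>
      does not cover.\<close>
    with \<open>u \<noteq> v\<close> obtain j where "k = Suc j" by (cases k) auto
    with k show "\<exists>k\<le>n. ((u, x), (v, y)) \<in> parcs K ^^ k"
      using walk_lift[OF ind _ x y] by blast
  qed
  then have "graph_dist (with_proj K) (u, x) (v, y) \<le> enat n \<longleftrightarrow>
      graph_dist (projection G K) u v \<le> enat n" for n
    unfolding K.graph_dist_le_iff[OF x'] \<pi>.graph_dist_le_iff[OF u] with_proj_simps .
  \<comment> \<open>Equal sets of finite upper bounds give equal distances, also when both are
    \<infinity>.\<close>
  then show ?thesis by - (rule antisym; rule enat_leI; simp)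
qed

section \<open>Neighbouring fibres and distances within a fibre\<close>

lemma (in pair_graph) neighbour_in_projection:
  assumes "graph_dist (projection G K) u v \<noteq> \<infinity>" and "u \<noteq> v" and "u \<in> verts (projection G K)"
  obtains w where "(u, w) \<in> arcs_ends (projection G K)"
proof -
  interpret \<pi>: wf_digraph "projection G K"
    by (intro wf_digraph_projection) unfold_locales
  obtain k where "(u, v) \<in> arcs_ends (projection G K) ^^ k"
    using assms \<pi>.graph_dist_le_iff by (metis enat.exhaust order_refl)
  \<comment> \<open>The walk has positive length since its ends differ, and its first arc leads to
    the neighbour.\<close>
  with \<open>u \<noteq> v\<close> that show thesis by (cases k) (auto elim: relpow_Suc_E2 simp del: relpow.simps(2))
qed

text \<open>The closed walk from \<open>u\<close> to \<open>w\<close> and back lifts to a walk of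
  length 2 between any two vertices of the fibre over \<open>u\<close>.\<close>

lemma graph_dist_fibre_le_2:
  assumes G: "pair_graph G"
    and ind: "induced_subgraph (with_proj K) (with_proj (lexicographic_product G H))"
    and x: "(u, x) \<in> pverts K" and y: "(u, y) \<in> pverts K"
    and w: "(u, w) \<in> arcs_ends (projection G K)"
  shows "graph_dist (with_proj K) (u, x) (u, y) \<le> 2"
proof -
  interpret G: pair_graph G by fact
  interpret K: wf_digraph "with_proj K"
    using ind by (simp add: induced_subgraph_def subgraph_def)
  have "(w, u) \<in> arcs_ends (projection G K)"
    using w G.arcs_symmetric by (auto simp: arcs_ends_projection_iff)
  with w have "(u, u) \<in> arcs_ends (projection G K) ^^ Suc (Suc 0)" by auto
  then have "((u, x), (u, y)) \<in> parcs K ^^ 2"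
    using walk_lift[OF ind _ x y] by (metis numeral_2_eq_2)
  then have "graph_dist (with_proj K) (u, x) (u, y) \<le> enat 2"
    using x K.graph_dist_le_iff[of "(u, x)" "(u, y)" 2] by auto
  then show ?thesis by (simp add: numeral_eq_enat)
qed

text \<open>All fibres of the product are nonempty once \<open>H\<close> has a vertex. This makes
  the results on projections applicable to the product, with \<open>G\<close> as its
  projection.\<close>

lemma projection_lexicographic_product:
  assumes "pair_graph G" and "pverts H \<noteq> {}"
  shows "projection G (lexicographic_product G H) = with_proj G"
proof -
  interpret pair_graph G by fact
  show ?thesis
    using assms(2)
    by (auto dest: arc_fst_in_verts arc_snd_in_verts simp: projection_def induce_subgraph_def with_proj_def lexicographic_product_def)
qed

lemma induced_subgraph_projection:
  assumes G: "pair_graph G"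
    and ind: "induced_subgraph (with_proj K) (with_proj (lexicographic_product G H))"
  shows "induced_subgraph (projection G K) (with_proj G)"
proof -
  interpret pair_graph G by fact
  have "{u. \<exists>x. (u, x) \<in> pverts K} \<subseteq> verts (with_proj G)"
    using ind by (auto simp: induced_subgraph_def subgraph_def lexicographic_product_def)
  then show ?thesis unfolding projection_def
    by (rule wf_digraph.induced_induce[rotated]) unfold_locales
qed

lemma (in pair_graph) graph_dist_finite_if_connected:
  assumes "Digraph_Component.connected (with_proj G)" and "u \<in> pverts G" and "v \<in> pverts G"
  shows "graph_dist (with_proj G) u v \<noteq> \<infinity>"
proof -
  interpret wf_digraph "with_proj G" by unfold_locales
  have "u \<rightarrow>\<^sup>*\<^bsub>with_proj G\<^esub> v"
    using symmetric_connected_imp_strongly_connected[OF pair_sym_arcs assms(1)] assms(2,3)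
    by (simp add: strongly_connected_def)
  then obtain p where "awalk u p v" by (auto simp: reachable_awalk)
  then have "graph_dist (with_proj G) u v \<le> enat (length p)"
    using awalk_imp_relpow_arcs_ends graph_dist_le_iff[of u v "length p"] assms(2) by auto
  then show ?thesis using enat_ile by fastforce
qed

lemma ex_other_of_card_ge_2:
  assumes "card A \<ge> 2"
  obtains b where "b \<in> A" and "b \<noteq> a"
proof -
  have "\<not> A \<subseteq> {a}"
    using assms card_mono[of "{a}" A] by auto
  then show thesis using that by auto
qed

theorem corollary3p4:
  fixes G :: "'a pair_pre_digraph" and H :: "'b pair_pre_digraph"
    and K :: "('a \<times> 'b) pair_pre_digraph"
  assumes "pair_graph G" and "Digraph_Component.connected (with_proj G)"
    and "card (pverts G) \<ge> 2"
    and "pair_graph H"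
    and "induced_subgraph (with_proj K) (with_proj (lexicographic_product G H))"
    and "pverts K \<noteq> {}"
  shows "(card (verts (projection G K)) \<ge> 2 \<longrightarrow>
            (isometric_subgraph (with_proj K) (with_proj (lexicographic_product G H)) \<longleftrightarrow>
             isometric_subgraph (projection G K) (with_proj G))) \<and>
         (card (verts (projection G K)) = 1 \<longrightarrow>
            (isometric_subgraph (with_proj K) (with_proj (lexicographic_product G H)) \<longleftrightarrow>
             graph_diam (with_proj K) \<le> 2))"
proof -
  let ?P = "lexicographic_product G H"
  let ?d = "\<lambda>K. graph_dist (with_proj K)"
  let ?\<pi> = "projection G K"
  note ind = assms(5)
  interpret G: pair_graph G by fact
  interpret P: pair_graph ?P by (rule pair_graph_lexicographic_product) fact+
  have wfG: "wf_digraph (with_proj G)" and wfP: "wf_digraph (with_proj ?P)" by unfold_locales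
  \<comment> \<open>The product is regarded as an induced subgraph of itself, so that the lemmas
    about \<open>K\<close> also compute distances in \<open>?P\<close>.\<close>
  have indP: "induced_subgraph (with_proj ?P) (with_proj ?P)"
    using wfP by (rule wf_digraph.induced_subgraph_refl)
  have KP: "pverts K \<subseteq> pverts ?P"
    using ind by (auto simp: induced_subgraph_def subgraph_def)
  then have "pverts H \<noteq> {}"
    using assms(6) by (auto simp: lexicographic_product_def)
  with assms(1) have projP: "projection G ?P = with_proj G"
    by (rule projection_lexicographic_product)
  have subK: "subgraph (with_proj K) (with_proj ?P)"
    using ind by (rule induced_imp_subgraph)
  have sub\<pi>: "subgraph ?\<pi> (with_proj G)"
    using assms(1) ind by (intro induced_imp_subgraph induced_subgraph_projection)
  have distK: "?d K (u, x) (v, y) = graph_dist ?\<pi> u v"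
    and distP: "?d ?P (u, x) (v, y) = ?d G u v"
    if "(u, x) \<in> pverts K" "(v, y) \<in> pverts K" "u \<noteq> v" for u x v y
    using graph_dist_projection[OF wfG ind that] graph_dist_projection[OF wfG indP, of u x v y]
      that KP projP by auto
  have "isometric_subgraph (with_proj K) (with_proj ?P) \<longleftrightarrow> isometric_subgraph ?\<pi> (with_proj G)"
    if card: "card (verts ?\<pi>) \<ge> 2"
  proof
    assume iso: "isometric_subgraph (with_proj K) (with_proj ?P)"
    have "graph_dist ?\<pi> u v = ?d G u v"
      if x: "(u, x) \<in> pverts K" and y: "(v, y) \<in> pverts K" for u x v y
    proof (cases "u = v")
      case True
      interpret \<pi>: wf_digraph ?\<pi> using wfG by (rule wf_digraph_projection)
      have u: "u \<in> verts ?\<pi>" using x by auto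
      \<comment> \<open>The distance from \<open>u\<close> to itself in the projection is 0, hence
        at most 2.\<close>
      show ?thesis
        using graph_dist_eq_if_le_2[OF induced_subgraph_projection[OF assms(1) ind] u u]
          \<pi>.graph_dist_le_iff[OF u, of u 0] True
        by (simp flip: zero_enat_def)
    next
      case False
      then show ?thesis
        using distK[OF x y] distP[OF x y] iso x y by (simp add: isometric_subgraph_def)
    qed
    then show "isometric_subgraph ?\<pi> (with_proj G)"
      using sub\<pi> by (auto simp: isometric_subgraph_def)
  next
    assume iso: "isometric_subgraph ?\<pi> (with_proj G)"
    have "?d K (u, x) (v, y) = ?d ?P (u, x) (v, y)"
      if x: "(u, x) \<in> pverts K" and y: "(v, y) \<in> pverts K" for u x v y
    proof (cases "u = v")
      case True
      have u: "u \<in> verts ?\<pi>" using x by auto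
      \<comment> \<open>The distance from \<open>u\<close> to \<open>w\<close> is finite in
        \<open>G\<close> by connectedness, hence finite in the projection by isometry. So
        \<open>u\<close> has a neighbour inside the projection, and the detour through its fibre
        stays in \<open>K\<close>.\<close>
      obtain w where w: "w \<in> verts ?\<pi>" "w \<noteq> u"
        using card by (rule ex_other_of_card_ge_2)
      have "u \<in> pverts G" "w \<in> pverts G"
        using u w(1) sub\<pi> by (auto simp: subgraph_def simp del: verts_projection)
      then have "?d G u w \<noteq> \<infinity>"
        using assms(2) by (intro G.graph_dist_finite_if_connected)
      then have "graph_dist ?\<pi> u w \<noteq> \<infinity>"
        using iso u w(1) by (simp add: isometric_subgraph_def del: verts_projection)
      then obtain z where "(u, z) \<in> arcs_ends ?\<pi>"
        using w(2) u by (metis G.neighbour_in_projection)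
      then have "?d K (u, x) (v, y) \<le> 2"
        using True x y graph_dist_fibre_le_2[OF assms(1) ind] by simp
      then show ?thesis
        using graph_dist_eq_if_le_2[OF ind] x y by simp
    next
      case False
      then show ?thesis
        using distK[OF x y] distP[OF x y] iso verts_projection[of u G K] verts_projection[of v G K] x y
        by (auto simp: isometric_subgraph_def simp del: verts_projection)
    qed
    then show "isometric_subgraph (with_proj K) (with_proj ?P)"
      using subK by (auto simp: isometric_subgraph_def)
  qed
  moreover have "isometric_subgraph (with_proj K) (with_proj ?P) \<longleftrightarrow> graph_diam (with_proj K) \<le> 2"
    if "card (verts ?\<pi>) = 1"
  proof -
    obtain u where \<pi>: "verts ?\<pi> = {u}"
      using \<open>card (verts ?\<pi>) = 1\<close> by (rule card_1_singletonE)
    then have K: "\<exists>x. a = (u, x)" if "a \<in> pverts K" for a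
      using that verts_projection[of "fst a" G K] by (cases a) auto
    have diam: "graph_diam (with_proj K) \<le> 2 \<longleftrightarrow> (\<forall>a\<in>pverts K. \<forall>b\<in>pverts K. ?d K a b \<le> 2)"
      by (auto simp: graph_diam_def SUP_le_iff)
    have u: "u \<in> pverts G"
      using \<pi> sub\<pi> by (auto simp: subgraph_def simp del: verts_projection)
    \<comment> \<open>With a single fibre in \<open>K\<close>, the neighbour of \<open>u\<close> has
      to come from \<open>G\<close>; the detour through it bounds distances in the product, not yet
      in \<open>K\<close>.\<close>
    obtain w where w: "w \<in> pverts G" "w \<noteq> u"
      using assms(3) by (rule ex_other_of_card_ge_2)
    have "?d G u w \<noteq> \<infinity>"
      using assms(2) u w(1) by (rule G.graph_dist_finite_if_connected)
    then obtain z where z: "(u, z) \<in> arcs_ends (projection G ?P)"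
      using w(2) u G.neighbour_in_projection[of ?P u w] projP by auto
    have le2: "?d ?P (u, x) (u, y) \<le> 2" if "(u, x) \<in> pverts K" "(u, y) \<in> pverts K" for x y
      by (rule graph_dist_fibre_le_2[OF assms(1) indP _ _ z]) (use that KP in blast)+
    show ?thesis
    proof
      assume iso: "isometric_subgraph (with_proj K) (with_proj ?P)"
      have "?d K a b \<le> 2" if a: "a \<in> pverts K" and b: "b \<in> pverts K" for a b
      proof -
        obtain x y where "a = (u, x)" "b = (u, y)"
          using K[OF a] K[OF b] by blast
        with a b le2 iso show ?thesis by (simp add: isometric_subgraph_def)
      qed
      then show "graph_diam (with_proj K) \<le> 2"
        unfolding diam by blast
    next
      \<comment> \<open>All distances in \<open>K\<close> are at most 2, and such distances in an
        induced subgraph agree with those of the product.\<close>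
      assume "graph_diam (with_proj K) \<le> 2"
      then show "isometric_subgraph (with_proj K) (with_proj ?P)"
        using graph_dist_eq_if_le_2[OF ind] subK by (simp add: diam isometric_subgraph_def)
    qed
  qed
  ultimately show ?thesis by blast
qed

end
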